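(* Let $I\subset\Bbbk[x_0,\dots,x_n]$ be a nonzero proper saturated Borel ideal with Hilbert polynomial $P:=P_I$. If $I\ne L^P_n$, then $\deg K_{L^P_n}>\deg K_I$; equivalently, $\deg HS_{L^P_n}>\deg HS_I$.
   Context: $\Bbbk$ is an algebraically closed field, $S=\Bbbk[x_0,\dots,x_n]$ standard graded. For a homogeneous ideal $I$, $H_I(i)=\dim_\Bbbk(S/I)_i$, $P_I$ is the Hilbert polynomial of $S/I$, and the Hilbert series $HS_I(T)=\sum_{i}H_I(i)T^i$ equals $K_I(T)/(1-T)^{n+1}$ for a polynomial $K_I\in\mathbb{Z}[T]$ (the $K$-polynomial); $\deg HS_I:=\deg K_I-(n+1)$. A monomial ideal $I$ is Borel if for every monomial $m\in I$, every variable $x_j$ dividing $m$ and every $i<j$, $m x_i/x_j\in I$; it is saturated if $(I:\langle x_0,\dots,x_n\rangle^\infty)=I$. Lexicographic order: $x^u>x^v$ if the first nonzero coordinate of $u-v$ is positive. For a homogeneous ideal $J$ with Hilbert function $H$, $L^H_n$ is the monomial ideal whose degree-$i$ piece is spanned by the $\dim_\Bbbk J_i$ lexicographically largest degree-$i$ monomials; for $P$ the Hilbert polynomial of a homogeneous ideal $J\subsetneq S$ with $\deg P<n$, the lexicographic ideal $L^P_n$ is the saturation of $L^{H_J}_n$ with respect to $\langle x_0,\dots,x_n\rangle$ (it depends only on $P$ and $n$). *)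

theory Defs
  imports Main
begin

text \<open>Monomials of S = k[x_0,...,x_n] are encoded by exponent vectors
  a :: nat \<Rightarrow> nat with a i = 0 for i > n.  A monomial ideal of S is encoded
  by the set of exponent vectors of the monomials it contains (it is spanned by them).
  All notions below (Borel, saturated, Hilbert function, K-polynomial, lex ideal)
  depend only on this set of monomials.\<close>

definition mons :: "nat \<Rightarrow> (nat \<Rightarrow> nat) set" where
  "mons n = {a. \<forall>i>n. a i = 0}"

definition mdeg :: "nat \<Rightarrow> (nat \<Rightarrow> nat) \<Rightarrow> nat" where
  "mdeg n a = (\<Sum>i\<le>n. a i)"

definition mons_deg :: "nat \<Rightarrow> nat \<Rightarrow> (nat \<Rightarrow> nat) set" where
  "mons_deg n d = {a \<in> mons n. mdeg n a = d}"

definition monomial_ideal :: "nat \<Rightarrow> (nat \<Rightarrow> nat) set \<Rightarrow> bool" where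
  "monomial_ideal n I \<longleftrightarrow> I \<subseteq> mons n \<and> (\<forall>a\<in>I. \<forall>b\<in>mons n. (\<lambda>i. a i + b i) \<in> I)"

definition borel :: "nat \<Rightarrow> (nat \<Rightarrow> nat) set \<Rightarrow> bool" where
  "borel n I \<longleftrightarrow> (\<forall>a\<in>I. \<forall>i j. i < j \<and> j \<le> n \<and> 0 < a j \<longrightarrow>
       a(i := a i + 1, j := a j - 1) \<in> I)"

text \<open>Saturation w.r.t. the maximal ideal m = <x_0,...,x_n>: for a monomial ideal J,
  (J : m^\<infinity>) is the monomial ideal spanned by the monomials u with u m^k \<subseteq> J
  for some k, i.e. u v \<in> J for all monomials v of degree k.\<close>
definition sat :: "nat \<Rightarrow> (nat \<Rightarrow> nat) set \<Rightarrow> (nat \<Rightarrow> nat) set" where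
  "sat n J = {a \<in> mons n. \<exists>k. \<forall>b\<in>mons_deg n k. (\<lambda>i. a i + b i) \<in> J}"

definition saturated :: "nat \<Rightarrow> (nat \<Rightarrow> nat) set \<Rightarrow> bool" where
  "saturated n I \<longleftrightarrow> sat n I = I"

definition hilb :: "nat \<Rightarrow> (nat \<Rightarrow> nat) set \<Rightarrow> nat \<Rightarrow> nat" where
  "hilb n I d = card {a \<in> mons_deg n d. a \<notin> I}"

definition idim :: "nat \<Rightarrow> (nat \<Rightarrow> nat) set \<Rightarrow> nat \<Rightarrow> nat" where
  "idim n I d = card {a \<in> mons_deg n d. a \<in> I}"

text \<open>K-polynomial: K_I(T) = HS_I(T) (1-T)^(n+1); its j-th coefficient.\<close>
definition Kcoeff :: "nat \<Rightarrow> (nat \<Rightarrow> nat) set \<Rightarrow> nat \<Rightarrow> int" where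
  "Kcoeff n I j = (\<Sum>i\<le>j. (-1) ^ i * int ((n + 1) choose i) * int (hilb n I (j - i)))"

definition Kdeg :: "nat \<Rightarrow> (nat \<Rightarrow> nat) set \<Rightarrow> nat" where
  "Kdeg n I = (GREATEST j. Kcoeff n I j \<noteq> 0)"

definition HSdeg :: "nat \<Rightarrow> (nat \<Rightarrow> nat) set \<Rightarrow> int" where
  "HSdeg n I = int (Kdeg n I) - int (n + 1)"

definition lex_gt :: "(nat \<Rightarrow> nat) \<Rightarrow> (nat \<Rightarrow> nat) \<Rightarrow> bool" where
  "lex_gt a b \<longleftrightarrow> (\<exists>k. (\<forall>i<k. a i = b i) \<and> b k < a k)"

definition lex_seg :: "nat \<Rightarrow> nat \<Rightarrow> nat \<Rightarrow> (nat \<Rightarrow> nat) set" where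
  "lex_seg n d c = {a \<in> mons_deg n d. card {b \<in> mons_deg n d. lex_gt b a} < c}"

definition lexH :: "nat \<Rightarrow> (nat \<Rightarrow> nat) set \<Rightarrow> (nat \<Rightarrow> nat) set" where
  "lexH n I = (\<Union>d. lex_seg n d (idim n I d))"

definition lexP :: "nat \<Rightarrow> (nat \<Rightarrow> nat) set \<Rightarrow> (nat \<Rightarrow> nat) set" where
  "lexP n I = sat n (lexH n I)"

end

(* A saturated Borel ideal is a cone over its part in x_0, ..., x_(n-1); inverting x_(n-1) there
   gives a saturated Borel ideal J in one variable less, and the two differ by finitely many
   monomials, c_e of them in degree e.  Passing from J to I adds (1 - T)^n (sum c_e T^e) to the
   K-polynomial.  Saturated lexicographic ideals are exactly the sets of monomials that are lex at
   least some m free of x_n, so if m' of degree r works for J, then m = m' x_(n-1)^C works for I,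
   with C forced by the Hilbert polynomial; its K-polynomial gains
   (1 - T)^n (T^r + ... + T^(r+C-1)), of degree r + C - 1 + n.  As J is generated in degrees at
   most r, the c_e with e >= r are positive until they vanish, hence c_e = 0 for e >= r + C.  If
   c_(r+C-1) is not 0, then all C removed monomials are accounted for, one in each degree
   r, ..., r+C-1; J is then lexicographic by induction, and Borel-fixedness forces the removed
   monomials to be m' x_(n-1)^t, so that I is lexicographic too. *)
theory Submission
  imports Defs
begin

section \<open>Saturated Borel ideals and the passage to one variable less\<close>

text \<open>For Borel ideals the last clause expresses saturation: membership can be tested after
  deleting x_n. The unit ideal is included, since \<open>colon\<close> can produce it.\<close>

definition sat_borel :: "nat \<Rightarrow> (nat \<Rightarrow> nat) set \<Rightarrow> bool" where
  "sat_borel n I \<longleftrightarrow> monomial_ideal n I \<and> borel n I \<and> I \<noteq> {} \<and> (\<forall>a\<in>I. a(n := 0) \<in> I)"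

text \<open>Generation in degrees at most \<open>r\<close>: every monomial of larger degree in
  \<open>I\<close> is a variable times a monomial of \<open>I\<close>.\<close>

definition gens_le :: "nat \<Rightarrow> (nat \<Rightarrow> nat) set \<Rightarrow> nat \<Rightarrow> bool" where
  "gens_le n I r \<longleftrightarrow> (\<forall>a\<in>I. r < mdeg n a \<longrightarrow> (\<exists>i\<le>n. 0 < a i \<and> a(i := a i - 1) \<in> I))"

text \<open>For a monomial ideal this is the effect of inverting x_k on the part of \<open>I\<close>
  in x_0, ..., x_k: some power of x_k carries \<open>a\<close> into \<open>I\<close>.\<close>

definition colon :: "nat \<Rightarrow> (nat \<Rightarrow> nat) set \<Rightarrow> (nat \<Rightarrow> nat) set" where
  "colon k I = {a \<in> mons k. \<exists>t. a(k := t) \<in> I}"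

text \<open>The numbers c_e of the outline above.\<close>

definition gap :: "nat \<Rightarrow> (nat \<Rightarrow> nat) set \<Rightarrow> nat \<Rightarrow> nat" where
  "gap k I e = card {a \<in> mons_deg k e. a \<in> colon k I \<and> a \<notin> I}"

text \<open>For \<open>m\<close> with \<open>m n = 0\<close> these are the nonzero saturated lexicographic ideals;
  \<open>m\<close> is the lex smallest minimal generator.\<close>
definition lexup :: "nat \<Rightarrow> (nat \<Rightarrow> nat) \<Rightarrow> (nat \<Rightarrow> nat) set" where
  "lexup n m = {a \<in> mons n. a = m \<or> lex_gt a m}"

section \<open>Coefficients of power series multiplied by powers of 1 - T\<close>

text \<open>The coefficient of T^j in (1 - T)^N times the generating series of
  \<open>h\<close>.\<close>

definition Kc :: "nat \<Rightarrow> (nat \<Rightarrow> nat) \<Rightarrow> nat \<Rightarrow> int" where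
  "Kc N h j = (\<Sum>i\<le>j. (-1) ^ i * int (N choose i) * int (h (j - i)))"

lemma Kcoeff_Kc: "Kcoeff n I j = Kc (Suc n) (hilb n I) j"
  by (simp add: Kcoeff_def Kc_def)

lemma Kc_add: "Kc N (\<lambda>e. f e + g e) j = Kc N f j + Kc N g j"
  by (simp add: Kc_def sum.distrib algebra_simps)

text \<open>Partial summation divides the generating series by 1 - T, which cancels one of the
  \<open>Suc N\<close> factors.\<close>

lemma Kc_partial_sums: "Kc (Suc N) (\<lambda>d. \<Sum>e\<le>d. h e) j = Kc N h j"
proof (cases j)
  case 0
  then show ?thesis by (simp add: Kc_def)
next
  case (Suc j')
  define H where "H = (\<lambda>d. \<Sum>e\<le>d. h e)"
  have pascal: "Kc (Suc N) H (Suc j') = Kc N H (Suc j') - Kc N H j'"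
    unfolding Kc_def sum.atMost_Suc_shift
    by (simp add: sum_subtractf[symmetric] sum.distrib[symmetric] sum_negf algebra_simps)
  have "Kc N H (Suc j') - Kc N H j'
      = (\<Sum>i\<le>j'. (-1) ^ i * int (N choose i) * (int (H (Suc j' - i)) - int (H (j' - i))))
        + (-1) ^ Suc j' * int (N choose Suc j') * int (H 0)"
    by (simp add: Kc_def sum_subtractf right_diff_distrib)
  also have "(\<Sum>i\<le>j'. (-1) ^ i * int (N choose i) * (int (H (Suc j' - i)) - int (H (j' - i))))
      = (\<Sum>i\<le>j'. (-1) ^ i * int (N choose i) * int (h (Suc j' - i)))"
    by (rule sum.cong) (auto simp: H_def Suc_diff_le)
  also have "\<dots> + (-1) ^ Suc j' * int (N choose Suc j') * int (H 0) = Kc N h (Suc j')"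
    by (simp add: Kc_def H_def)
  finally show ?thesis
    using pascal Suc by (simp add: H_def)
qed

lemma Kc_eq_0:
  assumes "\<And>e. s \<le> e \<Longrightarrow> c e = 0" "s + N \<le> j"
  shows "Kc N c j = 0"
  unfolding Kc_def
proof (rule sum.neutral, rule ballI)
  fix i assume "i \<in> {..j}"
  show "(-1) ^ i * int (N choose i) * int (c (j - i)) = 0"
  proof (cases "i \<le> N")
    case True
    then have "c (j - i) = 0" using assms by auto
    then show ?thesis by simp
  qed (simp add: binomial_eq_0)
qed

text \<open>The series of \<open>c\<close> is a polynomial of degree at most \<open>s\<close>, so
  this is the product of its coefficient at T^s with the leading coefficient of (1 - T)^N.\<close>

lemma Kc_top:
  assumes "\<And>e. s < e \<Longrightarrow> c e = 0"
  shows "Kc N c (s + N) = (-1) ^ N * int (c s)"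
proof -
  have "Kc N c (s + N) = (\<Sum>i\<le>s + N. if i = N then (-1) ^ N * int (c s) else 0)"
    unfolding Kc_def
  proof (rule sum.cong)
    fix i assume "i \<in> {..s + N}"
    show "(-1) ^ i * int (N choose i) * int (c (s + N - i)) = (if i = N then (-1) ^ N * int (c s) else 0)"
    proof (cases i N rule: linorder_cases)
      case less
      then have "c (s + N - i) = 0" by (intro assms) simp
      then show ?thesis using less by simp
    qed (simp_all add: binomial_eq_0)
  qed simp
  then show ?thesis by simp
qed

section \<open>Exponent vectors and their degrees\<close>

lemma mons_upd [simp]: "a \<in> mons n \<Longrightarrow> i \<le> n \<Longrightarrow> a(i := x) \<in> mons n"
  by (auto simp: mons_def)

lemma mons_SucD [simp]: "a \<in> mons k \<Longrightarrow> a \<in> mons (Suc k)"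
  by (auto simp: mons_def)

lemma mons_Suc_iff: "a \<in> mons k \<longleftrightarrow> a \<in> mons (Suc k) \<and> a (Suc k) = 0"
  by (auto simp: mons_def) (metis Suc_lessI)

lemma mons_zero_upd [simp]: "a \<in> mons (Suc k) \<Longrightarrow> a(Suc k := 0) \<in> mons k"
  by (simp add: mons_Suc_iff[of _ k])

lemma mons_beyond: "a \<in> mons n \<Longrightarrow> n < i \<Longrightarrow> a i = 0"
  by (simp add: mons_def)

lemma mdeg_upd: "i \<le> n \<Longrightarrow> mdeg n (a(i := x)) + a i = mdeg n a + x"
  unfolding mdeg_def by (simp add: sum.remove[of "{..n}" i])

lemma mdeg_Suc: "mdeg (Suc k) a = mdeg k a + a (Suc k)"
  by (simp add: mdeg_def)

lemma mdeg_upd_beyond [simp]: "n < i \<Longrightarrow> mdeg n (a(i := x)) = mdeg n a"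
  by (simp add: mdeg_def)

lemma mdeg_add: "mdeg n (\<lambda>i. a i + b i) = mdeg n a + mdeg n b"
  by (simp add: mdeg_def sum.distrib)

lemma mdeg_ge: "i \<le> n \<Longrightarrow> a i \<le> mdeg n a"
  unfolding mdeg_def by (rule member_le_sum) auto

lemma finite_mons_deg [simp]: "finite (mons_deg n d)"
proof (rule finite_subset)
  show "mons_deg n d \<subseteq> {a. \<forall>i. (i \<in> {..n} \<longrightarrow> a i \<in> {..d}) \<and> (i \<notin> {..n} \<longrightarrow> a i = 0)}"
    by (auto simp: mons_deg_def mons_def mdeg_ge)
  show "finite {a. \<forall>i. (i \<in> {..n} \<longrightarrow> a i \<in> {..d}) \<and> (i \<notin> {..n} \<longrightarrow> a i = (0::nat))}"
    by (rule finite_set_of_finite_funs) auto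
qed

section \<open>Monomial ideals and Borel moves\<close>

lemma monomial_ideal_mult:
  "monomial_ideal n I \<Longrightarrow> a \<in> I \<Longrightarrow> b \<in> mons n \<Longrightarrow> (\<lambda>i. a i + b i) \<in> I"
  unfolding monomial_ideal_def by (elim conjE) (drule bspec, assumption, erule bspec)

lemma monomial_ideal_ge:
  assumes "monomial_ideal n I" "a \<in> I" "b \<in> mons n" "\<And>i. a i \<le> b i"
  shows "b \<in> I"
proof -
  have b: "b = (\<lambda>i. a i + (b i - a i))" using assms(4) by (simp add: fun_eq_iff)
  have "(\<lambda>i. b i - a i) \<in> mons n" using assms(3) unfolding mons_def by simp
  from monomial_ideal_mult[OF assms(1,2) this] show ?thesis by (subst b)
qed

lemma monomial_ideal_mons: "monomial_ideal n I \<Longrightarrow> a \<in> I \<Longrightarrow> a \<in> mons n"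
  unfolding monomial_ideal_def by blast

lemma borelD:
  "borel n I \<Longrightarrow> a \<in> I \<Longrightarrow> i < j \<Longrightarrow> j \<le> n \<Longrightarrow> 0 < a j \<Longrightarrow> a(i := a i + 1, j := a j - 1) \<in> I"
  unfolding borel_def by blast

text \<open>Borel moves turn the power of x_j of degree \<open>mdeg j b\<close> into
  \<open>b\<close>, one factor at a time; the induction counts the factors of \<open>b\<close> other
  than x_j.\<close>

lemma borel_replace_power:
  assumes "borel n I" "j \<le> n" "b \<in> mons j" "c(j := c j + mdeg j b) \<in> I"
  shows "(\<lambda>i. c i + b i) \<in> I"
  using assms(3,4)
proof (induction "mdeg j b - b j" arbitrary: b)
  case 0
  have eq: "mdeg j b = (\<Sum>i<j. b i) + b j"
    by (simp add: mdeg_def lessThan_Suc_atMost[symmetric])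
  then have z: "\<forall>i<j. b i = 0" and "mdeg j b = b j" using 0(1) by auto
  then have "c(j := c j + mdeg j b) = (\<lambda>i. c i + b i)"
    using 0(2) by (auto simp: fun_eq_iff mons_def) (metis linorder_neqE_nat)
  then show ?case using 0 by simp
next
  case (Suc s)
  have eq: "mdeg j b = (\<Sum>i<j. b i) + b j"
    by (simp add: mdeg_def lessThan_Suc_atMost[symmetric])
  then have "(\<Sum>i<j. b i) \<noteq> 0" using Suc(2) by linarith
  then obtain i where i: "i < j" "b i \<noteq> 0" by (metis lessThan_iff sum.neutral)
  \<comment> \<open>Here one factor x_i of \<open>b\<close> is turned back into x_j; a single Borel
    move undoes this after the induction hypothesis has been applied.\<close>
  define b' where "b' = b(i := b i - 1, j := b j + 1)"
  have "mdeg j b' = mdeg j b"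
    using mdeg_upd[of i j b "b i - 1"] mdeg_upd[of j j "b(i := b i - 1)" "b j + 1"] i
    by (simp add: b'_def)
  moreover have "b' \<in> mons j" using Suc(3) i by (simp add: b'_def)
  moreover have "b' j = b j + 1" "b' i = b i - 1" using i by (simp_all add: b'_def)
  ultimately have "(\<lambda>i. c i + b' i) \<in> I"
    using Suc(2-4) by (intro Suc(1)) auto
  then have "(\<lambda>i. c i + b' i)(i := c i + b' i + 1, j := c j + b' j - 1) \<in> I"
    using \<open>b' j = b j + 1\<close> by (intro borelD[OF assms(1) _ i(1) assms(2)]) auto
  also have "(\<lambda>i. c i + b' i)(i := c i + b' i + 1, j := c j + b' j - 1) = (\<lambda>i. c i + b i)"
    using i by (simp add: b'_def fun_eq_iff)
  finally show ?case .
qed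

text \<open>Every product of \<open>a(n := 0)\<close> with a monomial of degree \<open>a n\<close>
  arises from \<open>a\<close> by trading factors x_n for other variables, so
  \<open>a(n := 0)\<close> lies in the saturation with exponent \<open>a n\<close>.\<close>

lemma sat_borelI:
  assumes "monomial_ideal n I" "I \<noteq> {}" "saturated n I" "borel n I"
  shows "sat_borel n I"
  unfolding sat_borel_def
proof (intro conjI ballI assms)
  fix a assume a: "a \<in> I"
  have "(\<lambda>i. (a(n := 0)) i + b i) \<in> I" if "b \<in> mons_deg n (a n)" for b
  proof (rule borel_replace_power[OF assms(4) order_refl])
    show "b \<in> mons n" using that by (simp add: mons_deg_def)
    have "(a(n := 0))(n := (a(n := 0)) n + mdeg n b) = a"
      using that by (simp add: mons_deg_def)
    then show "(a(n := 0))(n := (a(n := 0)) n + mdeg n b) \<in> I" using a by simp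
  qed
  moreover have "a(n := 0) \<in> mons n" using monomial_ideal_mons[OF assms(1) a] by simp
  ultimately have "a(n := 0) \<in> sat n I" unfolding sat_def by blast
  then show "a(n := 0) \<in> I" using assms(3) by (simp add: saturated_def)
qed

lemma sat_borel_iff:
  assumes "sat_borel n I" "a \<in> mons n"
  shows "a(n := 0) \<in> I \<longleftrightarrow> a \<in> I"
proof
  assume "a(n := 0) \<in> I"
  with assms show "a \<in> I"
    by (intro monomial_ideal_ge[of n I "a(n := 0)" a]) (auto simp: sat_borel_def)
next
  assume "a \<in> I"
  then show "a(n := 0) \<in> I" using assms(1) unfolding sat_borel_def by blast
qed

section \<open>Inverting x_k: Hilbert function and K-polynomial\<close>

lemma colon_sat_borel:
  assumes "sat_borel (Suc k) I"
  shows "sat_borel k (colon k I)"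
proof -
  have mi: "monomial_ideal (Suc k) I" and bo: "borel (Suc k) I"
    and ne: "I \<noteq> {}" and z: "\<And>a. a \<in> I \<Longrightarrow> a(Suc k := 0) \<in> I"
    using assms by (auto simp: sat_borel_def)
  have "monomial_ideal k (colon k I)"
    unfolding monomial_ideal_def
  proof (intro conjI ballI)
    fix a b assume a: "a \<in> colon k I" and b: "b \<in> mons k"
    then obtain t where t: "a(k := t) \<in> I" and am: "a \<in> mons k" by (auto simp: colon_def)
    have m: "(\<lambda>i. a i + b i) \<in> mons k" using am b by (simp add: mons_def)
    have "(\<lambda>i. a i + b i)(k := t) \<in> I"
      by (rule monomial_ideal_ge[OF mi t]) (use m in auto)
    then show "(\<lambda>i. a i + b i) \<in> colon k I" using m by (auto simp: colon_def)
  qed (auto simp: colon_def)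
  moreover have "borel k (colon k I)"
    unfolding borel_def
  proof (intro ballI allI impI)
    fix a i j assume a: "a \<in> colon k I" and ij: "i < j \<and> j \<le> k \<and> 0 < a j"
    obtain t where t: "a(k := t) \<in> I" and am: "a \<in> mons k" using a by (auto simp: colon_def)
    let ?b = "a(i := a i + 1, j := a j - 1)"
    have m: "?b \<in> mons k" using am ij by simp
    have "?b(k := t) \<in> I"
    \<comment> \<open>For \<open>j = k\<close> the exponent lowered by the move is overwritten by
      \<open>t\<close>, so the result is a multiple of \<open>a(k := t)\<close>; otherwise the move
      commutes with this overwriting.\<close>
    proof (cases "j = k")
      case True
      have "?b(k := t) \<in> mons (Suc k)" using mons_upd[OF m order_refl] by (rule mons_SucD)
      then show ?thesis by (rule monomial_ideal_ge[OF mi t]) (use True in auto)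
    next
      case False
      from borelD[OF bo t, of i j] False ij
      have "(a(k := t))(i := a i + 1, j := a j - 1) \<in> I" by auto
      also have "(a(k := t))(i := a i + 1, j := a j - 1) = ?b(k := t)"
        using False ij by (auto simp: fun_eq_iff)
      finally show ?thesis .
    qed
    then show "?b \<in> colon k I" using m by (auto simp: colon_def)
  qed
  moreover have "colon k I \<noteq> {}"
  proof -
    obtain a where a: "a \<in> I" using ne by auto
    have "(a(Suc k := 0))(k := a k) = a(Suc k := 0)" by auto
    then have "a(Suc k := 0) \<in> colon k I"
      unfolding colon_def using z[OF a] monomial_ideal_mons[OF mi a] by (auto intro!: exI[of _ "a k"])
    then show ?thesis by auto
  qed
  moreover have "a(k := 0) \<in> colon k I" if "a \<in> colon k I" for a
    using that by (auto simp: colon_def)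
  ultimately show ?thesis by (auto simp: sat_borel_def)
qed

lemma in_colon: "a \<in> I \<Longrightarrow> a \<in> mons k \<Longrightarrow> a \<in> colon k I"
  by (auto simp: colon_def intro!: exI[of _ "a k"])

lemma hilb_colon_gap: "hilb k I e = hilb k (colon k I) e + gap k I e"
proof -
  have "{a \<in> mons_deg k e. a \<notin> I}
      = {a \<in> mons_deg k e. a \<notin> colon k I} \<union> {a \<in> mons_deg k e. a \<in> colon k I \<and> a \<notin> I}"
    using in_colon by (auto simp: mons_deg_def)
  then show ?thesis
    unfolding hilb_def gap_def by (simp add: card_Un_disjoint disjoint_iff)
qed

text \<open>A monomial of degree \<open>d\<close> outside the cone is given by its part in x_0, ...,
  x_k, of some degree \<open>e \<le> d\<close>; the exponent of the last variable is then
  \<open>d - e\<close>.\<close>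

lemma hilb_Suc:
  assumes inv: "\<And>a. a \<in> mons (Suc k) \<Longrightarrow> a(Suc k := 0) \<in> I \<longleftrightarrow> a \<in> I"
  shows "hilb (Suc k) I d = (\<Sum>e\<le>d. hilb k I e)"
proof -
  let ?A = "{a \<in> mons_deg (Suc k) d. a \<notin> I}"
  let ?B = "\<lambda>e. {a \<in> mons_deg k e. a \<notin> I}"
  have "bij_betw (\<lambda>a. a(Suc k := 0)) ?A (\<Union>e\<in>{..d}. ?B e)"
  proof (rule bij_betw_byWitness[where f' = "\<lambda>a. a(Suc k := d - mdeg k a)"])
    show "\<forall>a\<in>?A. (a(Suc k := 0))(Suc k := d - mdeg k (a(Suc k := 0))) = a"
      by (auto simp: mons_deg_def mdeg_Suc)
    show "\<forall>a\<in>\<Union>e\<in>{..d}. ?B e. (a(Suc k := d - mdeg k a))(Suc k := 0) = a"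
      by (auto simp: mons_deg_def mons_def)
    show "(\<lambda>a. a(Suc k := 0)) ` ?A \<subseteq> (\<Union>e\<in>{..d}. ?B e)"
      using inv by (auto simp: mons_deg_def mdeg_Suc)
    show "(\<lambda>a. a(Suc k := d - mdeg k a)) ` (\<Union>e\<in>{..d}. ?B e) \<subseteq> ?A"
    proof clarsimp
      fix a e assume e: "e \<le> d" and a: "a \<in> mons_deg k e" "a \<notin> I"
      have "a(Suc k := 0) = a" using a by (auto simp: mons_deg_def mons_def)
      then show "a(Suc k := d - mdeg k a) \<in> mons_deg (Suc k) d \<and> a(Suc k := d - mdeg k a) \<notin> I"
        using inv[of "a(Suc k := d - mdeg k a)"] a e by (auto simp: mons_deg_def mdeg_Suc)
    qed
  qed
  then have "hilb (Suc k) I d = card (\<Union>e\<in>{..d}. ?B e)"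
    unfolding hilb_def by (rule bij_betw_same_card)
  also have "\<dots> = (\<Sum>e\<le>d. hilb k I e)"
    unfolding hilb_def by (rule card_UN_disjoint) (simp, simp, auto simp: mons_deg_def)
  finally show ?thesis .
qed

text \<open>The cone divides the Hilbert series by 1 - T, matching the additional factor 1 - T in
  the K-polynomial; what remains splits as \<open>hilb_colon_gap\<close> does.\<close>

lemma Kcoeff_Suc:
  assumes inv: "\<And>a. a \<in> mons (Suc k) \<Longrightarrow> a(Suc k := 0) \<in> I \<longleftrightarrow> a \<in> I"
  shows "Kcoeff (Suc k) I j = Kcoeff k (colon k I) j + Kc (Suc k) (gap k I) j"
proof -
  have "hilb (Suc k) I = (\<lambda>d. \<Sum>e\<le>d. hilb k I e)" using hilb_Suc[OF inv] by auto
  then have "Kcoeff (Suc k) I j = Kc (Suc k) (hilb k I) j"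
    by (simp add: Kcoeff_Kc Kc_partial_sums)
  also have "hilb k I = (\<lambda>e. hilb k (colon k I) e + gap k I e)"
    by (rule ext) (rule hilb_colon_gap)
  finally show ?thesis by (simp add: Kc_add Kcoeff_Kc)
qed

section \<open>The gap as a sequence: descent, vanishing and numerical consequences\<close>

lemma gap_pos_iff: "0 < gap k I e \<longleftrightarrow> (\<exists>a\<in>mons_deg k e. a \<in> colon k I \<and> a \<notin> I)"
  unfolding gap_def by (auto simp: card_gt_0_iff)

text \<open>Above degree \<open>r\<close> some variable can be divided out inside
  \<open>colon k I\<close>, and the quotient stays outside \<open>I\<close> because \<open>I\<close>
  is an ideal.\<close>

lemma gap_descend:
  assumes I: "sat_borel (Suc k) I" and g: "gens_le k (colon k I) r" and "r \<le> e"
    and a: "a \<in> mons_deg k (Suc e)" "a \<in> colon k I" "a \<notin> I"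
  obtains i where "i \<le> k" "0 < a i" "a(i := a i - 1) \<in> mons_deg k e"
    "a(i := a i - 1) \<in> colon k I" "a(i := a i - 1) \<notin> I"
proof -
  obtain i where i: "i \<le> k" "0 < a i" "a(i := a i - 1) \<in> colon k I"
    using g a assms(3) unfolding gens_le_def mons_deg_def by fastforce
  have "a(i := a i - 1) \<in> mons_deg k e"
    using mdeg_upd[of i k a "a i - 1"] i a by (auto simp: mons_deg_def)
  moreover have "a(i := a i - 1) \<notin> I"
  proof
    assume h: "a(i := a i - 1) \<in> I"
    have "a \<in> I"
      by (rule monomial_ideal_ge[OF _ h])
        (use I a in \<open>auto simp: sat_borel_def mons_deg_def\<close>)
    then show False using a by simp
  qed
  ultimately show ?thesis using that i by blast
qed

lemma gap_pos_descend:
  assumes "sat_borel (Suc k) I" "gens_le k (colon k I) r" "r \<le> e" "0 < gap k I (Suc e)"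
  shows "0 < gap k I e"
proof -
  obtain a where "a \<in> mons_deg k (Suc e)" "a \<in> colon k I" "a \<notin> I"
    using assms(4) by (auto simp: gap_pos_iff)
  then show ?thesis
    using gap_descend[OF assms(1-3)] unfolding gap_pos_iff by blast
qed

lemma gens_le_divisor:
  assumes "gens_le n I r" "a \<in> I" "a \<in> mons n" "r \<le> mdeg n a"
  obtains b where "b \<in> I" "b \<in> mons_deg n r" "\<And>i. b i \<le> a i"
proof -
  have "\<exists>b\<in>I. b \<in> mons_deg n r \<and> (\<forall>i. b i \<le> a i)"
    using assms(2-4)
  proof (induction "mdeg n a - r" arbitrary: a)
    case 0
    then show ?case by (auto simp: mons_deg_def)
  next
    case (Suc s)
    then obtain i where i: "i \<le> n" "0 < a i" "a(i := a i - 1) \<in> I"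
      using assms(1) unfolding gens_le_def by (metis zero_less_Suc zero_less_diff)
    have "mdeg n (a(i := a i - 1)) + 1 = mdeg n a"
      using mdeg_upd[of i n a "a i - 1"] i by auto
    then obtain b where b: "b \<in> I" "b \<in> mons_deg n r" "\<forall>l. b l \<le> (a(i := a i - 1)) l"
      using Suc(1)[of "a(i := a i - 1)"] Suc(2-) i by fastforce
    have "b l \<le> a l" for l using b(3)[rule_format, of l] by (auto split: if_splits)
    then show ?case using b by auto
  qed
  then show ?thesis using that by blast
qed

text \<open>In large degree a monomial of \<open>colon k I\<close> is \<open>b\<close> times
  \<open>v\<close> with \<open>b\<close> of degree \<open>r\<close> and \<open>v\<close> of large
  degree. Then \<open>b\<close> times a high power of x_k lies in \<open>I\<close>, and Borel moves
  turn that power into \<open>v\<close>.\<close>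

lemma gap_eventually_0:
  assumes I: "sat_borel (Suc k) I" and g: "gens_le k (colon k I) r"
  obtains N where "\<And>e. N \<le> e \<Longrightarrow> gap k I e = 0"
proof -
  have mi: "monomial_ideal (Suc k) I" and bo: "borel (Suc k) I"
    using I by (auto simp: sat_borel_def)
  let ?G = "{a \<in> mons_deg k r. a \<in> colon k I}"
  have "\<forall>a\<in>?G. \<exists>t. a(k := t) \<in> I" by (auto simp: colon_def)
  then obtain t where t: "\<And>a. a \<in> ?G \<Longrightarrow> a(k := t a) \<in> I" by metis
  \<comment> \<open>A bound on the powers of x_k that carry the finitely many degree
    \<open>r\<close> monomials of \<open>colon k I\<close> into \<open>I\<close>.\<close>
  define T where "T = Max (insert 0 (t ` ?G))"
  have tT: "t a \<le> T" if "a \<in> ?G" for a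
    unfolding T_def using that by (intro Max_ge) auto
  have "gap k I e = 0" if e: "r + T \<le> e" for e
  proof (rule ccontr)
    assume "gap k I e \<noteq> 0"
    then obtain a where a: "a \<in> mons_deg k e" "a \<in> colon k I" "a \<notin> I"
      using gap_pos_iff[of k I e] by auto
    obtain b where b: "b \<in> colon k I" "b \<in> mons_deg k r" "\<And>i. b i \<le> a i"
      using gens_le_divisor[OF g a(2)] a(1) e by (auto simp: mons_deg_def)
    let ?v = "\<lambda>i. a i - b i"
    have ab: "a = (\<lambda>i. b i + ?v i)" using b(3) by auto
    have v: "?v \<in> mons k" using a(1) by (auto simp: mons_deg_def mons_def)
    have "mdeg k a = mdeg k b + mdeg k ?v" by (subst ab) (rule mdeg_add)
    then have vT: "T \<le> mdeg k ?v" using a(1) b(2) e by (auto simp: mons_deg_def)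
    have "b(k := t b) \<in> I" using t b by auto
    then have "b(k := b k + mdeg k ?v) \<in> I"
    proof (rule monomial_ideal_ge[OF mi])
      show "b(k := b k + mdeg k ?v) \<in> mons (Suc k)" using b(2) by (auto simp: mons_deg_def)
      show "(b(k := t b)) i \<le> (b(k := b k + mdeg k ?v)) i" for i
        using tT[of b] vT b by auto
    qed
    then have "(\<lambda>i. b i + ?v i) \<in> I" by (intro borel_replace_power[OF bo _ v]) auto
    then show False using ab a(3) by simp
  qed
  then show ?thesis using that by blast
qed

text \<open>Here \<open>h\<close> and \<open>l\<close> are the Hilbert functions of \<open>J\<close> and of its lexicographic ideal, and
  \<open>C\<close> is the constant that equalises the partial sums for large degrees.\<close>
lemma gap_numerics:
  fixes c h l :: "nat \<Rightarrow> nat" and r N :: nat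
  assumes "\<forall>e. l e \<le> h e" and "\<forall>e\<ge>r. h e = l e"
    and "\<forall>e\<ge>r. 0 < c (Suc e) \<longrightarrow> 0 < c e" and "\<forall>e\<ge>N. c e = 0"
  defines "C \<equiv> (\<Sum>e<r. h e - l e) + (\<Sum>e<N. c e)"
  defines "ind \<equiv> \<lambda>e. if r \<le> e \<and> e < r + C then 1 else (0::nat)"
  shows "(\<Sum>e\<le>d. l e + ind e) \<le> (\<Sum>e\<le>d. h e + c e)"
    and "r + C \<le> d \<Longrightarrow> (\<Sum>e\<le>d. l e + ind e) = (\<Sum>e\<le>d. h e + c e)"
    and "r + C \<le> e \<Longrightarrow> c e = 0"
    and "0 < C \<Longrightarrow> 0 < c (r + C - 1) \<Longrightarrow> h = l \<and> c = ind"
    and "C = 0 \<Longrightarrow> h = l \<and> c = ind"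
proof -
  note le = assms(1)[rule_format] and eq = assms(2)[rule_format]
    and desc = assms(3)[rule_format] and fin = assms(4)[rule_format]
  \<comment> \<open>\<open>C\<close> splits into the excess \<open>D\<close> of \<open>h\<close>
    over \<open>l\<close> and the total \<open>S\<close> of \<open>c\<close>.\<close>
  define D where "D = (\<Sum>e<r. h e - l e)"
  define S where "S = (\<Sum>e<N. c e)"
  have CDS: "C = D + S" by (simp add: C_def D_def S_def)
  have chain: "0 < c e'" if "0 < c e" "r \<le> e'" "e' \<le> e" for e e'
    using that(3,1,2)
  proof (induction rule: inc_induct)
    case base then show ?case by simp
  next
    case (step e') then show ?case using desc[of e'] by simp
  qed
  have tail: "(\<Sum>e\<in>A. c e) = S" if "finite A" "\<And>e. e \<notin> A \<Longrightarrow> c e = 0" for A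
  proof -
    have "(\<Sum>e\<in>A. c e) = (\<Sum>e\<in>A \<union> {..<N}. c e)"
      by (rule sum.mono_neutral_left) (use that in auto)
    also have "\<dots> = S" unfolding S_def
      by (rule sum.mono_neutral_right) (use that fin in \<open>auto simp: not_less\<close>)
    finally show ?thesis .
  qed
  have sub: "(\<Sum>e\<in>A. c e) \<le> S" if "finite A" for A
  proof -
    have "(\<Sum>e\<in>A. c e) \<le> (\<Sum>e\<in>A \<union> {..<N}. c e)"
      by (rule sum_mono2) (use that in auto)
    also have "\<dots> = S" by (rule tail) (use that fin in \<open>auto simp: not_less\<close>)
    finally show ?thesis .
  qed
  have ones: "e - e' \<le> (\<Sum>x=e'..<e. c x)" if "r \<le> e'" "0 < c (e - 1)" for e e'
  proof -
    have "(\<Sum>x=e'..<e. 1) \<le> (\<Sum>x=e'..<e. c x)"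
      by (rule sum_mono) (use chain[of "e - 1"] that in \<open>auto simp: Suc_le_eq\<close>)
    then show ?thesis by simp
  qed
  \<comment> \<open>By descent a positive value at \<open>e\<close> makes \<open>c\<close> positive
    in all degrees from \<open>r\<close> to \<open>e\<close>, which are more than \<open>C\<close>
    degrees, while the total \<open>S\<close> is at most \<open>C\<close>.\<close>
  show c0: "c e = 0" if "r + C \<le> e" for e
  proof (rule ccontr)
    assume "c e \<noteq> 0"
    then have "Suc e - r \<le> (\<Sum>x=r..<Suc e. c x)" by (intro ones) auto
    also have "\<dots> \<le> S" by (rule sub) simp
    finally show False using that CDS by simp
  qed
  have Dsum: "(\<Sum>e\<le>d. h e - l e) = D" if "r \<le> Suc d" for d
    unfolding D_def by (rule sum.mono_neutral_right) (use that eq in auto)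
  have hl: "(\<Sum>e\<le>d. h e + c e) = (\<Sum>e\<le>d. l e) + (\<Sum>e\<le>d. h e - l e) + (\<Sum>e\<le>d. c e)" for d
    using le by (simp add: sum.distrib[symmetric])
  have lind: "(\<Sum>e\<le>d. l e + ind e) = (\<Sum>e\<le>d. l e) + min C (Suc d - r)" for d
  proof -
    have "(\<Sum>e\<le>d. ind e) = card ({..d} \<inter> {e. r \<le> e \<and> e < r + C})"
      by (simp add: ind_def sum.If_cases)
    also have "{..d} \<inter> {e. r \<le> e \<and> e < r + C} = {r..<min (Suc d) (r + C)}" by auto
    finally have "(\<Sum>e\<le>d. ind e) = min (Suc d) (r + C) - r" by simp
    also have "\<dots> = min C (Suc d - r)" by linarith
    finally show ?thesis by (simp add: sum.distrib)
  qed
  show "(\<Sum>e\<le>d. l e + ind e) \<le> (\<Sum>e\<le>d. h e + c e)"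
  proof (cases "r \<le> d")
    case True
    show ?thesis
    \<comment> \<open>If \<open>c\<close> vanishes after \<open>d\<close>, both parts of
      \<open>C\<close> are already summed up; otherwise \<open>c\<close> is positive in every degree
      from \<open>r\<close> to \<open>d\<close> and outweighs the indicator there.\<close>
    proof (cases "c (Suc d) = 0")
      case c: True
      have "(\<Sum>e\<le>d. c e) = S"
        by (rule tail) (use chain[of _ "Suc d"] c True in \<open>auto simp: not_le Suc_le_eq\<close>)
      then show ?thesis using hl[of d] lind[of d] Dsum[of d] True CDS by simp
    next
      case False
      then have "0 < c d" using desc True by simp
      then have "Suc d - r \<le> (\<Sum>x=r..<Suc d. c x)" by (intro ones) auto
      also have "\<dots> \<le> (\<Sum>e\<le>d. c e)" by (rule sum_mono2) auto
      finally show ?thesis using hl[of d] lind[of d] by simp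
    qed
  next
    case False
    then show ?thesis using hl[of d] lind[of d] by simp
  qed
  show "(\<Sum>e\<le>d. l e + ind e) = (\<Sum>e\<le>d. h e + c e)" if "r + C \<le> d"
  proof -
    have "(\<Sum>e\<le>d. c e) = S" by (rule tail) (use c0 that in auto)
    then show ?thesis using hl[of d] lind[of d] Dsum[of d] that CDS by simp
  qed
  have D0: "h = l" if "D = 0"
  proof
    fix e
    have "r \<le> e \<or> h e - l e = 0" using that by (auto simp: D_def)
    then show "h e = l e" using le[of e] eq[of e] by auto
  qed
  show "h = l \<and> c = ind" if "0 < C" "0 < c (r + C - 1)"
  proof -
    \<comment> \<open>The \<open>C\<close> degrees from \<open>r\<close> to \<open>r + C - 1\<close>
      already use up at least \<open>C\<close>, so nothing is left for \<open>D\<close> or for the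
      degrees below \<open>r\<close>, and each value there is exactly 1.\<close>
    have C: "C \<le> (\<Sum>x=r..<r + C. c x)" using ones[of r "r + C"] that by simp
    also have "\<dots> \<le> S" by (rule sub) simp
    finally have "D = 0" "S = C" using CDS by auto
    have "S = (\<Sum>x<r + C. c x)" by (rule tail[symmetric]) (use c0 in auto)
    also have "\<dots> = (\<Sum>x<r. c x) + (\<Sum>x=r..<r + C. c x)"
      by (metis le_add1 lessThan_atLeast0 sum.atLeastLessThan_concat zero_le)
    finally have low: "(\<Sum>x<r. c x) = 0" and mid: "(\<Sum>x=r..<r + C. c x) = C"
      using C \<open>S = C\<close> by linarith+
    have pos: "1 \<le> c x" if "x \<in> {r..<r + C}" for x
      using chain[of "r + C - 1" x] \<open>0 < c (r + C - 1)\<close> that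
      by fastforce
    have "(\<Sum>x=r..<r + C. c x - 1) = 0"
      using mid sum_subtractf_nat[of "{r..<r + C}" "\<lambda>_. 1" c] pos by simp
    then have "c x = 1" if "x \<in> {r..<r + C}" for x
      using that pos[OF that] by (auto simp: le_antisym)
    then have "c x = ind x" for x
      using low c0[of x] by (auto simp: ind_def not_le not_less)
    then show ?thesis using D0 \<open>D = 0\<close> by auto
  qed
  show "h = l \<and> c = ind" if "C = 0"
  proof -
    have "D = 0" "S = 0" using that CDS by auto
    have "c x = ind x" for x
      using \<open>S = 0\<close> fin[of x] that by (cases "x < N") (auto simp: S_def ind_def)
    then show ?thesis using D0 \<open>D = 0\<close> by auto
  qed
qed

section \<open>The lexicographic order and saturated lexicographic ideals\<close>

lemma lex_gt_trans:
  assumes "lex_gt a b" "lex_gt b c"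
  shows "lex_gt a c"
proof -
  obtain i where i: "\<And>l. l < i \<Longrightarrow> a l = b l" "b i < a i" using assms(1) by (auto simp: lex_gt_def)
  obtain j where j: "\<And>l. l < j \<Longrightarrow> b l = c l" "c j < b j" using assms(2) by (auto simp: lex_gt_def)
  have "a l = c l" if "l < min i j" for l using i(1)[of l] j(1)[of l] that by simp
  moreover have "c (min i j) < a (min i j)"
    using i(1)[of j] i(2) j(1)[of i] j(2) by (cases i j rule: linorder_cases) simp_all
  ultimately show ?thesis unfolding lex_gt_def by blast
qed

lemma lex_gt_irrefl [simp]: "\<not> lex_gt a a"
  by (simp add: lex_gt_def)

lemma lex_gt_total: "a \<noteq> b \<Longrightarrow> lex_gt a b \<or> lex_gt b a"
proof -
  assume "a \<noteq> b"
  then have ex: "\<exists>i. a i \<noteq> b i" by auto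
  define i where "i = (LEAST i. a i \<noteq> b i)"
  have "a i \<noteq> b i" unfolding i_def by (rule LeastI_ex[OF ex])
  moreover have "\<forall>l<i. a l = b l" unfolding i_def using not_less_Least by blast
  ultimately show ?thesis unfolding lex_gt_def by (metis linorder_neqE_nat)
qed

lemma lex_gt_add: "lex_gt (\<lambda>i. a i + b i) a \<or> (\<lambda>i. a i + b i) = a"
proof (rule ccontr)
  assume *: "\<not> ?thesis"
  then have "lex_gt a (\<lambda>i. a i + b i)" using lex_gt_total by blast
  then show False by (auto simp: lex_gt_def)
qed

lemma lexup_add: "a \<in> lexup n m \<Longrightarrow> b \<in> mons n \<Longrightarrow> (\<lambda>i. a i + b i) \<in> lexup n m"
  using lex_gt_add[of a b] lex_gt_trans[of "\<lambda>i. a i + b i" a m] by (auto simp: lexup_def mons_def)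

lemma lexup_lex_gt: "a \<in> lexup n m \<Longrightarrow> b \<in> mons n \<Longrightarrow> lex_gt b a \<Longrightarrow> b \<in> lexup n m"
  using lex_gt_trans[of b a m] by (auto simp: lexup_def)

text \<open>As \<open>m n = 0\<close>, a monomial that agrees with \<open>m\<close> before
  coordinate \<open>n\<close> is \<open>m\<close> itself or lex larger. Hence the exponent of x_n
  does not enter, which makes \<open>lexup n m\<close> a cone.\<close>

lemma lexup_iff:
  assumes "m \<in> mons n" "m n = 0" "a \<in> mons n"
  shows "a \<in> lexup n m \<longleftrightarrow>
    (\<exists>i<n. (\<forall>l<i. a l = m l) \<and> m i < a i) \<or> (\<forall>l<n. a l = m l)" (is "_ \<longleftrightarrow> ?E \<or> ?F")
proof
  assume "a \<in> lexup n m"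
  then consider "a = m" | i where "\<forall>l<i. a l = m l" "m i < a i"
    by (auto simp: lexup_def lex_gt_def)
  then show "?E \<or> ?F"
  proof cases
    case 2
    then show ?thesis by (cases "i < n") auto
  qed simp
next
  assume "?E \<or> ?F"
  then show "a \<in> lexup n m"
  proof
    assume ?E
    then show ?thesis using assms by (auto simp: lexup_def lex_gt_def)
  next
    assume F: ?F
    show ?thesis
    proof (cases "a n = 0")
      case True
      have "a l = m l" for l
        using F True assms by (cases l n rule: linorder_cases) (auto simp: mons_def)
      then have "a = m" by auto
      then show ?thesis using assms by (simp add: lexup_def)
    next
      case False
      then have "lex_gt a m" using F assms(2) unfolding lex_gt_def by auto
      then show ?thesis using assms by (simp add: lexup_def)
    qed
  qed
qed

lemma lexup_upd_last:
  assumes "m \<in> mons n" "m n = 0" "a \<in> mons n"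
  shows "a(n := x) \<in> lexup n m \<longleftrightarrow> a \<in> lexup n m"
proof -
  have "a(n := x) \<in> mons n" using assms by simp
  moreover have "(\<exists>i<n. (\<forall>l<i. (a(n := x)) l = m l) \<and> m i < (a(n := x)) i)
      \<longleftrightarrow> (\<exists>i<n. (\<forall>l<i. a l = m l) \<and> m i < a i)"
    by (intro ex_cong1 conj_cong) auto
  ultimately show ?thesis
    using lexup_iff[OF assms(1,2), of "a(n := x)"] lexup_iff[OF assms] by simp
qed

lemma lexup_Suc_iff:
  assumes "m \<in> mons k" "a \<in> mons (Suc k)"
  shows "a \<in> lexup (Suc k) (m(k := C)) \<longleftrightarrow>
    (\<exists>i<k. (\<forall>l<i. a l = m l) \<and> m i < a i) \<or> (\<forall>l<k. a l = m l) \<and> C \<le> a k"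
proof -
  have "m(k := C) \<in> mons (Suc k)" "(m(k := C)) (Suc k) = 0"
    using assms(1) by (auto simp: mons_def)
  note * = lexup_iff[OF this assms(2)]
  have "(\<exists>i<k. (\<forall>l<i. a l = (m(k := C)) l) \<and> (m(k := C)) i < a i)
      \<longleftrightarrow> (\<exists>i<k. (\<forall>l<i. a l = m l) \<and> m i < a i)"
    by (intro ex_cong1 conj_cong) auto
  moreover have "(\<forall>l<k. a l = (m(k := C)) l) \<longleftrightarrow> (\<forall>l<k. a l = m l)" by auto
  ultimately show ?thesis
    unfolding * All_less_Suc Ex_less_Suc by (simp add: le_less) blast
qed

text \<open>Raising the exponent of x_k in the bound from 0 to \<open>C\<close> affects only
  monomials that agree with \<open>m\<close> before coordinate \<open>k\<close>.\<close>

lemma lexup_restrict: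
  assumes "m \<in> mons k" "m k = 0" "a \<in> mons k"
  shows "a \<in> lexup (Suc k) (m(k := C)) \<longleftrightarrow> a \<in> lexup k m \<and> \<not> (\<exists>t<C. a = m(k := t))"
proof -
  let ?E = "\<exists>i<k. (\<forall>l<i. a l = m l) \<and> m i < a i" and ?F = "\<forall>l<k. a l = m l"
  let ?Q = "\<exists>t<C. a = m(k := t)"
  have 1: "?F \<and> \<not> C \<le> a k \<longleftrightarrow> ?Q"
  proof
    assume h: "?F \<and> \<not> C \<le> a k"
    have "a l = (m(k := a k)) l" for l
      using h assms by (cases l k rule: linorder_cases) (simp_all add: mons_def)
    then have "a = m(k := a k)" by (rule ext)
    then show ?Q using h not_le by blast
  next
    assume ?Q
    then obtain t where "t < C" "a = m(k := t)" by blast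
    then show "?F \<and> \<not> C \<le> a k" by simp
  qed
  have 2: "\<not> (?E \<and> ?F)" by auto
  show ?thesis
    unfolding lexup_iff[OF assms] lexup_Suc_iff[OF assms(1) mons_SucD[OF assms(3)]]
      1[symmetric] using 2 by argo
qed

lemma upd_in_lexup: "m \<in> mons k \<Longrightarrow> m k = 0 \<Longrightarrow> m(k := t) \<in> lexup k m"
  using lexup_upd_last[of m k m t] by (simp add: lexup_def)

lemma colon_lexup:
  assumes "m \<in> mons k" "m k = 0"
  shows "colon k (lexup (Suc k) (m(k := C))) = lexup k m"
proof (rule set_eqI)
  fix a
  show "a \<in> colon k (lexup (Suc k) (m(k := C))) \<longleftrightarrow> a \<in> lexup k m"
  proof (cases "a \<in> mons k")
    case True
    let ?E = "\<exists>i<k. (\<forall>l<i. a l = m l) \<and> m i < a i" and ?F = "\<forall>l<k. a l = m l"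
    have "a(k := t) \<in> lexup (Suc k) (m(k := C)) \<longleftrightarrow> ?E \<or> ?F \<and> C \<le> t" for t
    proof -
      have "(\<exists>i<k. (\<forall>l<i. (a(k := t)) l = m l) \<and> m i < (a(k := t)) i) \<longleftrightarrow> ?E"
        by (intro ex_cong1 conj_cong) auto
      moreover have "a(k := t) \<in> mons (Suc k)"
        using mons_upd[OF True order_refl] by (rule mons_SucD)
      ultimately show ?thesis using lexup_Suc_iff[OF assms(1), of "a(k := t)" C] by simp
    qed
    then show ?thesis
      using lexup_iff[OF assms True] True unfolding colon_def by blast
  qed (auto simp: colon_def lexup_def)
qed

lemma mdeg_upd_last: "m k = 0 \<Longrightarrow> mdeg k (m(k := t)) = mdeg k m + t"
  using mdeg_upd[of k k m t] by simp

text \<open>The gap consists of the monomials \<open>m(k := t)\<close> with \<open>t < C\<close>,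
  and these have pairwise different degrees.\<close>

lemma gap_lexup:
  assumes "m \<in> mons k" "m k = 0"
  shows "gap k (lexup (Suc k) (m(k := C))) e
    = (if mdeg k m \<le> e \<and> e < mdeg k m + C then 1 else 0)"
proof -
  let ?S = "{a \<in> mons_deg k e. a \<in> lexup k m \<and> a \<notin> lexup (Suc k) (m(k := C))}"
  have S: "?S = (\<lambda>t. m(k := t)) ` {t. t < C \<and> e = mdeg k m + t}"
  proof (intro equalityI subsetI)
    fix a assume "a \<in> ?S"
    then have a: "a \<in> mons k" "mdeg k a = e" "a \<in> lexup k m" "a \<notin> lexup (Suc k) (m(k := C))"
      by (simp_all add: mons_deg_def)
    then obtain t where "t < C" "a = m(k := t)" using lexup_restrict[OF assms a(1)] by blast
    then show "a \<in> (\<lambda>t. m(k := t)) ` {t. t < C \<and> e = mdeg k m + t}"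
      using mdeg_upd_last[of m k, OF assms(2)] a(2) by blast
  next
    fix a assume "a \<in> (\<lambda>t. m(k := t)) ` {t. t < C \<and> e = mdeg k m + t}"
    then obtain t where t: "t < C" "e = mdeg k m + t" "a = m(k := t)" by blast
    have "a \<in> mons k" using t(3) mons_upd[OF assms(1) order_refl] by simp
    moreover have "mdeg k a = e" using t mdeg_upd_last[of m k, OF assms(2)] by simp
    moreover have "a \<in> lexup k m" using t(3) upd_in_lexup[OF assms] by simp
    moreover have "a \<notin> lexup (Suc k) (m(k := C))"
      using lexup_restrict[OF assms] \<open>a \<in> mons k\<close> t by blast
    ultimately show "a \<in> ?S" by (simp add: mons_deg_def)
  qed
  have "inj_on (\<lambda>t. m(k := t)) {t. t < C \<and> e = mdeg k m + t}"
    by (rule inj_onI) (auto dest: fun_cong[of _ _ k])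
  then have "card ?S = card {t. t < C \<and> e = mdeg k m + t}" unfolding S by (rule card_image)
  also have "{t. t < C \<and> e = mdeg k m + t}
      = (if mdeg k m \<le> e \<and> e < mdeg k m + C then {e - mdeg k m} else {})"
    by auto
  finally have "card ?S = (if mdeg k m \<le> e \<and> e < mdeg k m + C then 1 else 0)"
    by (simp only: split: if_split) simp
  then show ?thesis unfolding gap_def colon_lexup[OF assms] .
qed

section \<open>Recognising a lexicographic ideal from the sizes of its gap\<close>

text \<open>The gap has at most one monomial in each degree, so it suffices to keep each
  \<open>m(k := t)\<close> with \<open>t < C\<close> out of \<open>I\<close>. This follows by
  induction on \<open>t\<close>: were it in \<open>I\<close>, a Borel move would bring the actual
  gap monomial into \<open>I\<close> as well.\<close>

lemma lexup_gap_unique: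
  assumes I: "sat_borel (Suc k) I" and co: "colon k I = lexup k m"
    and m: "m \<in> mons k" "m k = 0" and g: "gens_le k (lexup k m) (mdeg k m)"
    and gap: "\<And>e. gap k I e = (if mdeg k m \<le> e \<and> e < mdeg k m + C then 1 else 0)"
  shows "I = lexup (Suc k) (m(k := C))"
proof -
  let ?r = "mdeg k m"
  define R where "R = (\<lambda>e. {a. a \<in> mons_deg k e \<and> a \<in> colon k I \<and> a \<notin> I})"
  have mi: "monomial_ideal (Suc k) I" and bo: "borel (Suc k) I"
    using I by (auto simp: sat_borel_def)
  have cardR: "card (R e) = gap k I e" for e by (simp add: R_def gap_def)
  have finR: "finite (R e)" for e by (simp add: R_def)
  have uniq: "x = y" if "x \<in> R e" "y \<in> R e" for x y e
  proof -
    have "card (R e) \<le> 1" by (simp add: cardR gap)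
    then show ?thesis using that card_le_Suc0_iff_eq[OF finR] by simp
  qed
  have ex: "\<exists>x. x \<in> R e" if "?r \<le> e" "e < ?r + C" for e
    using cardR[of e] gap[of e] that by (metis card.empty ex_in_conv zero_neq_one)
  have range: "?r \<le> e \<and> e < ?r + C" if "x \<in> R e" for x e
    using cardR[of e] gap[of e] that finR[of e] by (metis card_0_eq empty_iff)
  have mon: "m(k := t) \<in> mons k" for t using m(1) by simp
  have inR: "m(k := t) \<in> R (?r + t)" if "m(k := t) \<notin> I" for t
    using that mon upd_in_lexup[OF m] mdeg_upd_last[of m k] m(2) unfolding R_def co
    by (simp add: mons_deg_def)
  \<comment> \<open>If \<open>m \<in> I\<close>, the monomial \<open>y\<close> of degree \<open>r\<close> missing from \<open>I\<close> is another minimal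
    generator of the lexicographic ideal; having the degree of \<open>m\<close>, it is a Borel move of \<open>m\<close>.\<close>
  have m_notin: "m \<notin> I" if "0 < C"
  proof
    assume "m \<in> I"
    obtain y where y: "y \<in> R ?r" using ex[of ?r] \<open>0 < C\<close> by auto
    then have yI: "y \<notin> I" and ym: "y \<in> mons k" and yl: "y \<in> lexup k m" and yd: "mdeg k y = ?r"
      by (auto simp: R_def co mons_deg_def)
    \<comment> \<open>The gap is empty in degree \<open>?r - 1\<close>, so such a divisor would lie
      in \<open>I\<close> and \<open>y\<close> with it.\<close>
    have no_divisor: "y(j := y j - 1) \<notin> lexup k m" if "j \<le> k" "0 < y j" for j
    proof
      assume h: "y(j := y j - 1) \<in> lexup k m"
      have d: "mdeg k (y(j := y j - 1)) + 1 = ?r"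
        using mdeg_upd[of j k y "y j - 1"] that yd by simp
      have "y(j := y j - 1) \<in> I"
      proof (rule ccontr)
        assume "y(j := y j - 1) \<notin> I"
        then have "y(j := y j - 1) \<in> R (mdeg k (y(j := y j - 1)))"
          using h ym that by (simp add: R_def co mons_deg_def)
        then show False using range d by fastforce
      qed
      then have "y \<in> I"
        by (rule monomial_ideal_ge[OF mi]) (use ym in auto)
      then show False using yI by simp
    qed
    have "y \<noteq> m" using yI \<open>m \<in> I\<close> by auto
    then obtain i where i: "\<And>l. l < i \<Longrightarrow> y l = m l" "m i < y i"
      using yl by (auto simp: lexup_def lex_gt_def)
    have ik: "i \<le> k" using i(2) ym by (metis mons_beyond not_le not_less_zero)
    have y_after: "y j = 0" if "i < j" for j
    proof (rule ccontr)
      assume "y j \<noteq> 0"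
      then have "j \<le> k" using ym by (metis mons_beyond not_le)
      moreover have "lex_gt (y(j := y j - 1)) m"
        unfolding lex_gt_def using i that by (intro exI[of _ i]) auto
      ultimately show False
        using no_divisor[of j] \<open>y j \<noteq> 0\<close> ym by (simp add: lexup_def)
    qed
    have y_at: "y i = m i + 1"
    proof (rule ccontr)
      assume "y i \<noteq> m i + 1"
      then have "lex_gt (y(i := y i - 1)) m"
        unfolding lex_gt_def using i by (intro exI[of _ i]) auto
      then show False
        using no_divisor[of i] i(2) ik ym by (simp add: lexup_def)
    qed
    \<comment> \<open>The part of \<open>m\<close> after coordinate \<open>i\<close>. Since
      \<open>y\<close> times \<open>m'\<close> is \<open>m\<close> times x_i, and \<open>y\<close>
      and \<open>m\<close> have equal degree, \<open>m'\<close> is a single variable x_j.\<close>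
    define m' where "m' = (\<lambda>l. if l \<le> i then 0 else m l)"
    have "mdeg k (\<lambda>l. y l + m' l) = mdeg k (m(i := m i + 1))"
      unfolding mdeg_def by (rule sum.cong) (use i(1) y_after y_at in \<open>auto simp: m'_def not_less\<close>)
    then have "mdeg k m' = 1"
      using mdeg_upd[OF ik, of m "m i + 1"] yd by (simp add: mdeg_add)
    then obtain j where j: "j \<le> k" "m' j = 1" and j': "\<And>l. l \<le> k \<Longrightarrow> l \<noteq> j \<Longrightarrow> m' l = 0"
      unfolding mdeg_def by (auto simp: sum_eq_Suc0_iff)
    have ij: "i < j" using j(2) by (auto simp: m'_def split: if_splits)
    have "y l = (m(i := m i + 1, j := m j - 1)) l" for l
    proof (cases l i rule: linorder_cases)
      case less
      then show ?thesis using i(1) ij by simp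
    next
      case equal
      then show ?thesis using y_at ij by simp
    next
      case greater
      have "m l = 0" if "l \<noteq> j" "l \<le> k" using j'[OF that(2,1)] greater by (simp add: m'_def)
      then have "m l = 0" if "l \<noteq> j" using that mons_beyond[OF m(1), of l] by (meson not_le)
      moreover have "m j = 1" using j(2) ij by (simp add: m'_def)
      ultimately show ?thesis using y_after[OF greater] greater by simp
    qed
    then have "y = m(i := m i + 1, j := m j - 1)" by (rule ext)
    moreover have "m(i := m i + 1, j := m j - 1) \<in> I"
      by (rule borelD[OF bo \<open>m \<in> I\<close> ij]) (use j ij in \<open>auto simp: m'_def\<close>)
    ultimately show False using yI by simp
  qed
  have notin: "m(k := t) \<notin> I" if "t < C" for t
    using that
  proof (induction t)
    case 0
    then show ?case using m_notin m(2) by (simp add: fun_upd_idem)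
  next
    case (Suc t)
    then have "m(k := t) \<notin> I" using Suc_lessD by blast
    then have tR: "m(k := t) \<in> R (?r + t)" by (rule inR)
    obtain y where y: "y \<in> R (?r + Suc t)" using ex[of "?r + Suc t"] Suc by auto
    then have yd: "y \<in> mons_deg k (Suc (?r + t))" "y \<in> colon k I" "y \<notin> I" by (auto simp: R_def)
    \<comment> \<open>Descent leads from \<open>y\<close> to the unique gap monomial one degree
      lower, which is \<open>m(k := t)\<close>. So \<open>y\<close> is x_i times it: either
      \<open>m(k := Suc t)\<close> itself or a Borel move of that monomial.\<close>
    obtain i where i: "i \<le> k" "0 < y i" and "y(i := y i - 1) \<in> R (?r + t)"
      using gap_descend[OF I _ _ yd, of ?r] g co unfolding R_def by auto
    then have yt: "y(i := y i - 1) = m(k := t)" using uniq tR by blast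
    have y_eq: "y = (m(k := t))(i := (m(k := t)) i + 1)"
      unfolding yt[symmetric] using i by auto
    show ?case
    proof (cases "i = k")
      case True
      then have "y = m(k := Suc t)" using y_eq by simp
      then show ?thesis using yd(3) by blast
    next
      case False
      show ?thesis
      proof
        assume h: "m(k := Suc t) \<in> I"
        have "(m(k := Suc t))(i := (m(k := Suc t)) i + 1, k := (m(k := Suc t)) k - 1) \<in> I"
          by (rule borelD[OF bo h]) (use False i in auto)
        also have "(m(k := Suc t))(i := (m(k := Suc t)) i + 1, k := (m(k := Suc t)) k - 1) = y"
          unfolding y_eq using False by (auto simp: fun_eq_iff)
        finally show False using yd(3) by simp
      qed
    qed
  qed
  have mem: "b \<in> I \<longleftrightarrow> b \<in> lexup (Suc k) (m(k := C))" if b: "b \<in> mons k" for b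
  proof -
    have "b \<in> lexup k m" if "b \<in> I" using in_colon[OF that b] co by simp
    moreover have "\<exists>t<C. b = m(k := t)" if "b \<in> lexup k m" "b \<notin> I"
    proof -
      have bR: "b \<in> R (mdeg k b)" using that b co by (simp add: R_def mons_deg_def)
      define t where "t = mdeg k b - ?r"
      have t: "t < C" "?r + t = mdeg k b" using range[OF bR] by (auto simp: t_def)
      then have "m(k := t) \<in> R (mdeg k b)" using inR[OF notin[OF t(1)]] by simp
      then show ?thesis using uniq[OF bR] t by blast
    qed
    ultimately show ?thesis using lexup_restrict[OF m b] notin by blast
  qed
  have mC: "m(k := C) \<in> mons (Suc k)" "(m(k := C)) (Suc k) = 0"
    using mons_SucD[OF mon] m(1) by (auto simp: mons_def)
  show ?thesis
  proof (rule set_eqI)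
    fix a
    show "a \<in> I \<longleftrightarrow> a \<in> lexup (Suc k) (m(k := C))"
    proof (cases "a \<in> mons (Suc k)")
      case True
      then have "a(Suc k := 0) \<in> mons k" by simp
      from mem[OF this] show ?thesis
        unfolding sat_borel_iff[OF I True] lexup_upd_last[OF mC True] .
    next
      case False
      then show ?thesis using monomial_ideal_mons[OF mi] by (auto simp: lexup_def)
    qed
  qed
qed

section \<open>The induction on the number of variables\<close>

lemma hilb_unit: "hilb n (mons n) d = 0"
proof -
  have "{a \<in> mons_deg n d. a \<notin> mons n} = {}" by (auto simp: mons_deg_def)
  then show ?thesis unfolding hilb_def by (simp only: card.empty)
qed

lemma Kcoeff_unit: "Kcoeff n (mons n) j = 0"
  by (simp add: Kcoeff_def hilb_unit)

text \<open>The generation bound and the two Hilbert function comparisons feed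
  \<open>gap_numerics\<close> in the next step; the vanishing from \<open>mdeg n m + n\<close> on
  lets the gap decide the top coefficients. The strict comparison uses a witness \<open>j0\<close>
  instead of degrees, since the K-polynomial of the unit ideal is zero.\<close>

lemma sat_borel_dominated_by_lexup:
  assumes "sat_borel n I"
  shows "\<exists>m. m \<in> mons n \<and> m n = 0 \<and>
    (\<forall>d. hilb n (lexup n m) d \<le> hilb n I d) \<and>
    (\<forall>d\<ge>mdeg n m. hilb n (lexup n m) d = hilb n I d) \<and>
    gens_le n I (mdeg n m) \<and>
    (\<forall>j\<ge>mdeg n m + n. Kcoeff n I j = 0 \<and> Kcoeff n (lexup n m) j = 0) \<and>
    (I \<noteq> lexup n m \<longrightarrow> (\<exists>j0. Kcoeff n (lexup n m) j0 \<noteq> 0 \<and> (\<forall>j\<ge>j0. Kcoeff n I j = 0)))"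
  using assms
proof (induction n arbitrary: I)
  case 0
  have mi: "monomial_ideal 0 I" and "I \<noteq> {}" and z: "\<And>a. a \<in> I \<Longrightarrow> a(0 := 0) \<in> I"
    using 0 by (auto simp: sat_borel_def)
  then obtain a where "a \<in> I" by auto
  \<comment> \<open>In one variable, deleting x_0 from any monomial of \<open>I\<close> leaves 1, so
    \<open>I\<close> is the unit ideal.\<close>
  have "a(0 := 0) = (\<lambda>_. 0)"
    using monomial_ideal_mons[OF mi \<open>a \<in> I\<close>] by (auto simp: mons_def fun_eq_iff)
  then have "(\<lambda>_. 0) \<in> I" using z[OF \<open>a \<in> I\<close>] by simp
  then have I: "I = mons 0"
    using monomial_ideal_ge[OF mi, of "\<lambda>_. 0"] monomial_ideal_mons[OF mi] by auto
  have L: "lexup 0 (\<lambda>_. 0) = mons 0"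
    using lexup_iff[of "\<lambda>_. 0" 0] by (auto simp: lexup_def mons_def)
  show ?case
    unfolding I
    by (intro exI[of _ "\<lambda>_. 0"]) (simp_all add: L Kcoeff_unit gens_le_def, simp_all add: mons_def mdeg_def)
next
  case (Suc k)
  let ?J = "colon k I"
  have mi: "monomial_ideal (Suc k) I" using Suc.prems by (simp add: sat_borel_def)
  obtain m where m: "m \<in> mons k" "m k = 0"
    and le: "\<And>d. hilb k (lexup k m) d \<le> hilb k ?J d"
    and eq: "\<And>d. mdeg k m \<le> d \<Longrightarrow> hilb k (lexup k m) d = hilb k ?J d"
    and gJ: "gens_le k ?J (mdeg k m)"
    and K0: "\<And>j. mdeg k m + k \<le> j \<Longrightarrow> Kcoeff k ?J j = 0 \<and> Kcoeff k (lexup k m) j = 0"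
    and Kneq: "?J \<noteq> lexup k m \<longrightarrow>
      (\<exists>j0. Kcoeff k (lexup k m) j0 \<noteq> 0 \<and> (\<forall>j\<ge>j0. Kcoeff k ?J j = 0))"
    using Suc.IH[OF colon_sat_borel[OF Suc.prems]] by blast
  let ?r = "mdeg k m" and ?c = "gap k I"
  obtain N where N: "\<And>e. N \<le> e \<Longrightarrow> ?c e = 0" using gap_eventually_0[OF Suc.prems gJ] by blast
  \<comment> \<open>The value for which \<open>I\<close> and
    \<open>lexup (Suc k) (m(k := C))\<close> have equal Hilbert functions in large degrees.\<close>
  define C where "C = (\<Sum>e<?r. hilb k ?J e - hilb k (lexup k m) e) + (\<Sum>e<N. ?c e)"
  have "\<forall>e. hilb k (lexup k m) e \<le> hilb k ?J e" "\<forall>e\<ge>?r. hilb k ?J e = hilb k (lexup k m) e"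
    "\<forall>e\<ge>?r. 0 < ?c (Suc e) \<longrightarrow> 0 < ?c e" "\<forall>e\<ge>N. ?c e = 0"
    using le eq gap_pos_descend[OF Suc.prems gJ] N by simp_all
  note num = gap_numerics[OF this, folded C_def]
  define M where "M = m(k := C)"
  let ?L = "lexup (Suc k) M"
  define ind where "ind = (\<lambda>e. if ?r \<le> e \<and> e < ?r + C then 1 else (0::nat))"
  have gapL: "gap k ?L = ind" by (rule ext) (simp add: M_def gap_lexup[OF m] ind_def)
  have coL: "colon k ?L = lexup k m" by (simp add: M_def colon_lexup[OF m])
  have "m(k := C) \<in> mons k" using m(1) by simp
  then have M: "M \<in> mons (Suc k)" "M (Suc k) = 0"
    unfolding M_def by (rule mons_SucD) (use m(1) in \<open>simp add: mons_def\<close>)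
  have degM: "mdeg (Suc k) M = ?r + C"
    using mdeg_upd_last[of m k C] m(2) M(2) by (simp add: mdeg_Suc M_def)
  have hI: "hilb (Suc k) I d = (\<Sum>e\<le>d. hilb k ?J e + ?c e)" for d
    using hilb_Suc[OF sat_borel_iff[OF Suc.prems], of d] hilb_colon_gap[of k I] by simp
  have hL: "hilb (Suc k) ?L d = (\<Sum>e\<le>d. hilb k (lexup k m) e + ind e)" for d
    using hilb_Suc[OF lexup_upd_last[OF M], of d] hilb_colon_gap[of k ?L] gapL coL by simp
  have KI: "Kcoeff (Suc k) I j = Kcoeff k ?J j + Kc (Suc k) ?c j" for j
    by (rule Kcoeff_Suc) (rule sat_borel_iff[OF Suc.prems])
  have KL: "Kcoeff (Suc k) ?L j = Kcoeff k (lexup k m) j + Kc (Suc k) ind j" for j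
    using Kcoeff_Suc[OF lexup_upd_last[OF M], of j] gapL coL by simp
  have c0: "?c e = 0" if "?r + C \<le> e" for e using num(3)[OF that] .
  have lex_case: "I = ?L" if "hilb k ?J = hilb k (lexup k m)" "?c = ind"
  proof -
    \<comment> \<open>Equal K-polynomials contradict the strict comparison in the induction
      hypothesis unless \<open>?J\<close> is lexicographic.\<close>
    have "Kcoeff k ?J = Kcoeff k (lexup k m)" using that(1) by (simp add: Kcoeff_def fun_eq_iff)
    then have "?J = lexup k m" using Kneq by fastforce
    moreover from this gJ have "gens_le k (lexup k m) ?r" by simp
    ultimately show ?thesis unfolding M_def
      using lexup_gap_unique[OF Suc.prems _ m, of C] fun_cong[OF that(2)] by (simp add: ind_def)
  qed
  show ?case
  proof (intro exI[of _ M] conjI allI impI M)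
    show "hilb (Suc k) ?L d \<le> hilb (Suc k) I d" for d
      unfolding hI hL ind_def by (rule num(1))
    show "hilb (Suc k) ?L d = hilb (Suc k) I d" if "mdeg (Suc k) M \<le> d" for d
      unfolding hI hL ind_def by (rule num(2)) (use that degM in simp)
    show "gens_le (Suc k) I (mdeg (Suc k) M)"
      unfolding gens_le_def
    proof (intro ballI impI)
      fix a assume a: "a \<in> I" and deg: "mdeg (Suc k) M < mdeg (Suc k) a"
      have am: "a \<in> mons (Suc k)" by (rule monomial_ideal_mons[OF mi a])
      show "\<exists>i\<le>Suc k. 0 < a i \<and> a(i := a i - 1) \<in> I"
      proof (cases "a (Suc k) = 0")
        case False
        have "(a(Suc k := a (Suc k) - 1))(Suc k := 0) \<in> I"
          using sat_borel_iff[OF Suc.prems am] a by simp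
        then have "a(Suc k := a (Suc k) - 1) \<in> I"
          using sat_borel_iff[OF Suc.prems, of "a(Suc k := a (Suc k) - 1)"] am by simp
        then show ?thesis using False by auto
      next
        case True
        then have ak: "a \<in> mons k" using am mons_Suc_iff by blast
        have d: "?r + C < mdeg k a" using deg degM True by (simp add: mdeg_Suc)
        then obtain i where i: "i \<le> k" "0 < a i" "a(i := a i - 1) \<in> ?J"
          using gJ in_colon[OF a ak] unfolding gens_le_def by fastforce
        \<comment> \<open>The quotient \<open>b\<close> lies in \<open>?J\<close> and has degree at
          least \<open>?r + C\<close>, where the gap is empty; hence it lies in
          \<open>I\<close>.\<close>
        define b where "b = a(i := a i - 1)"
        have "b \<in> mons_deg k (mdeg k b)" using ak i(1) by (simp add: b_def mons_deg_def)
        moreover have "?r + C \<le> mdeg k b"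
          using mdeg_upd[OF i(1), of a "a i - 1"] i(2) d by (simp add: b_def)
        then have "\<not> 0 < ?c (mdeg k b)" using c0 by simp
        ultimately have "b \<in> I" using i(3) unfolding gap_pos_iff b_def by blast
        then show ?thesis using i unfolding b_def by (auto intro!: exI[of _ i])
      qed
    qed
    fix j assume j: "mdeg (Suc k) M + Suc k \<le> j"
    show "Kcoeff (Suc k) I j = 0"
      unfolding KI using K0[of j] Kc_eq_0[of "?r + C" ?c "Suc k" j] c0 j degM by simp
    show "Kcoeff (Suc k) ?L j = 0"
      unfolding KL using K0[of j] Kc_eq_0[of "?r + C" ind "Suc k" j] j degM by (simp add: ind_def)
  next
    assume neq: "I \<noteq> ?L"
    \<comment> \<open>Both \<open>C = 0\<close> and a gap that reaches degree
      \<open>?r + C - 1\<close> are extremal cases of the numerics, in which \<open>I\<close> is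
      lexicographic.\<close>
    have "0 < C"
    proof (rule ccontr)
      assume "\<not> 0 < C"
      then show False using num(5) lex_case neq by (simp add: ind_def)
    qed
    have "?c (?r + C - 1) = 0"
    proof (rule ccontr)
      assume "?c (?r + C - 1) \<noteq> 0"
      then show False using num(4) \<open>0 < C\<close> lex_case neq by (simp add: ind_def)
    qed
    then have c1: "?c e = 0" if "?r + C - 1 \<le> e" for e
      using c0[of e] that by (cases "e = ?r + C - 1") auto
    \<comment> \<open>The degree of the K-polynomial of \<open>?L\<close>: its gap ends in degree
      \<open>?r + C - 1\<close>, and the contribution of \<open>lexup k m\<close> has vanished from
      \<open>?r + k\<close> on. The gap of \<open>I\<close> ends earlier.\<close>
    let ?j = "(?r + C - 1) + Suc k"
    have "Kc (Suc k) ind ?j = (-1) ^ Suc k * int (ind (?r + C - 1))"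
      by (rule Kc_top) (auto simp: ind_def)
    also have "ind (?r + C - 1) = 1" using \<open>0 < C\<close> by (auto simp: ind_def)
    finally have "Kcoeff (Suc k) ?L ?j \<noteq> 0" unfolding KL using K0[of ?j] \<open>0 < C\<close> by simp
    moreover have "Kcoeff (Suc k) I j = 0" if "?j \<le> j" for j
      unfolding KI using K0[of j] Kc_eq_0[of "?r + C - 1" ?c "Suc k" j] c1 that \<open>0 < C\<close> by simp
    ultimately show "\<exists>j0. Kcoeff (Suc k) ?L j0 \<noteq> 0 \<and> (\<forall>j\<ge>j0. Kcoeff (Suc k) I j = 0)" by blast
  qed
qed

section \<open>Identification of the lexicographic ideal and comparison of degrees\<close>

text \<open>By totality of the order, the monomials larger than \<open>a\<close> form a proper
  subset of \<open>U\<close> if \<open>a\<close> is in \<open>U\<close>, and contain all of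
  \<open>U\<close> otherwise.\<close>

lemma lex_segment_iff:
  assumes U: "U \<subseteq> mons_deg n d"
    and up: "\<And>a b. a \<in> U \<Longrightarrow> b \<in> mons_deg n d \<Longrightarrow> lex_gt b a \<Longrightarrow> b \<in> U"
  shows "lex_seg n d (card U) = U"
proof (rule set_eqI)
  fix a
  let ?G = "{b \<in> mons_deg n d. lex_gt b a}"
  have finU: "finite U" using U finite_subset finite_mons_deg by blast
  have "card ?G < card U \<longleftrightarrow> a \<in> U" if a: "a \<in> mons_deg n d"
  proof
    assume "a \<in> U"
    then have "?G \<subset> U" using up by auto
    then show "card ?G < card U" by (rule psubset_card_mono[OF finU])
  next
    assume less: "card ?G < card U"
    show "a \<in> U"
    proof (rule ccontr)
      assume "a \<notin> U"
      have "lex_gt u a" if "u \<in> U" for u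
        using that \<open>a \<notin> U\<close> up[OF that a] lex_gt_total[of u a] by auto
      then have "U \<subseteq> ?G" using U by auto
      then have "card U \<le> card ?G" by (intro card_mono) auto
      then show False using less by simp
    qed
  qed
  then show "a \<in> lex_seg n d (card U) \<longleftrightarrow> a \<in> U" using U by (auto simp: lex_seg_def)
qed

lemma idim_hilb: "idim n I d + hilb n I d = card (mons_deg n d)"
proof -
  have "{a \<in> mons_deg n d. a \<in> I} \<union> {a \<in> mons_deg n d. a \<notin> I} = mons_deg n d" by auto
  then show ?thesis
    unfolding idim_def hilb_def by (subst card_Un_disjoint[symmetric]) auto
qed

text \<open>The inequality puts \<open>lexH n I\<close> inside \<open>lexup n m\<close>, and both
  agree from degree \<open>r\<close> on. Saturation depends only on large degrees, and
  \<open>lexup n m\<close> is already saturated.\<close>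

lemma lexP_eq_lexup:
  assumes m: "m \<in> mons n" "m n = 0"
    and le: "\<And>d. hilb n (lexup n m) d \<le> hilb n I d"
    and eq: "\<And>d. r \<le> d \<Longrightarrow> hilb n (lexup n m) d = hilb n I d"
  shows "lexP n I = lexup n m"
proof -
  let ?L = "lexup n m"
  have seg: "lex_seg n d (idim n ?L d) = {a \<in> mons_deg n d. a \<in> ?L}" for d
    unfolding idim_def
  proof (rule lex_segment_iff)
    fix a b assume "a \<in> {a \<in> mons_deg n d. a \<in> ?L}" "b \<in> mons_deg n d" "lex_gt b a"
    then show "b \<in> {a \<in> mons_deg n d. a \<in> ?L}"
      using lexup_lex_gt[of a n m b] by (simp add: mons_deg_def)
  qed blast
  have "lex_seg n d (idim n I d) \<subseteq> ?L" for d
  proof -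
    have "idim n I d \<le> idim n ?L d" using idim_hilb[of n I d] idim_hilb[of n ?L d] le[of d] by linarith
    then have "lex_seg n d (idim n I d) \<subseteq> lex_seg n d (idim n ?L d)" by (auto simp: lex_seg_def)
    then show ?thesis using seg by auto
  qed
  then have sub: "lexH n I \<subseteq> ?L" unfolding lexH_def by blast
  have large: "a \<in> lexH n I" if "a \<in> ?L" "r \<le> mdeg n a" for a
  proof -
    have "idim n I (mdeg n a) = idim n ?L (mdeg n a)"
      using idim_hilb[of n I "mdeg n a"] idim_hilb[of n ?L "mdeg n a"] eq[OF that(2)] by linarith
    moreover have "a \<in> lex_seg n (mdeg n a) (idim n ?L (mdeg n a))"
      unfolding seg using that by (simp add: mons_deg_def lexup_def)
    ultimately show ?thesis unfolding lexH_def by (metis UN_I UNIV_I)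
  qed
  show ?thesis
    unfolding lexP_def sat_def
  proof (intro equalityI subsetI CollectI conjI)
    fix a assume "a \<in> {a \<in> mons n. \<exists>k. \<forall>b\<in>mons_deg n k. (\<lambda>i. a i + b i) \<in> lexH n I}"
    then obtain k where a: "a \<in> mons n" and k: "\<And>b. b \<in> mons_deg n k \<Longrightarrow> (\<lambda>i. a i + b i) \<in> lexH n I"
      by blast
    \<comment> \<open>Multiplication by this power of x_n suffices as a test, because
      \<open>lexup n m\<close> ignores the exponent of x_n.\<close>
    define b where "b = (\<lambda>i. if i = n then k else 0)"
    have "b \<in> mons_deg n k" by (auto simp: b_def mons_deg_def mons_def mdeg_def)
    then have "(\<lambda>i. a i + b i) \<in> ?L" using k sub by blast
    also have "(\<lambda>i. a i + b i) = a(n := a n + k)" by (auto simp: b_def)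
    finally show "a \<in> ?L" unfolding lexup_upd_last[OF m a] .
  next
    fix a assume a: "a \<in> ?L"
    then show "a \<in> mons n" by (simp add: lexup_def)
    have "(\<lambda>i. a i + b i) \<in> lexH n I" if "b \<in> mons_deg n r" for b
      using that lexup_add[OF a, of b] by (intro large) (auto simp: mons_deg_def mdeg_add)
    then show "\<exists>k. \<forall>b\<in>mons_deg n k. (\<lambda>i. a i + b i) \<in> lexH n I" by blast
  qed
qed

theorem theorem6p10:
  fixes n :: nat and I :: "(nat \<Rightarrow> nat) set"
  assumes "monomial_ideal n I"
    and "I \<noteq> {}"
    and "(\<lambda>_. 0) \<notin> I"
    and "saturated n I"
    and "borel n I"
    and "I \<noteq> lexP n I"
  shows "Kdeg n (lexP n I) > Kdeg n I \<and> HSdeg n (lexP n I) > HSdeg n I"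
proof -
  obtain m where m: "m \<in> mons n" "m n = 0"
    and le: "\<And>d. hilb n (lexup n m) d \<le> hilb n I d"
    and eq: "\<And>d. mdeg n m \<le> d \<Longrightarrow> hilb n (lexup n m) d = hilb n I d"
    and K0: "\<And>j. mdeg n m + n \<le> j \<Longrightarrow> Kcoeff n (lexup n m) j = 0"
    and Kneq: "I \<noteq> lexup n m \<longrightarrow>
      (\<exists>j0. Kcoeff n (lexup n m) j0 \<noteq> 0 \<and> (\<forall>j\<ge>j0. Kcoeff n I j = 0))"
    using sat_borel_dominated_by_lexup[OF sat_borelI[OF assms(1,2,4,5)]] by blast
  have L: "lexP n I = lexup n m" by (rule lexP_eq_lexup[OF m le eq])
  then obtain j0 where j0: "Kcoeff n (lexP n I) j0 \<noteq> 0" "\<And>j. j0 \<le> j \<Longrightarrow> Kcoeff n I j = 0"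
    using Kneq assms(6) by auto
  \<comment> \<open>As \<open>I\<close> is proper, its K-polynomial has constant coefficient 1;
    together with the bound \<open>j0\<close> this makes the \<open>GREATEST\<close> in
    \<open>Kdeg n I\<close> attained.\<close>
  have "{a \<in> mons_deg n 0. a \<notin> I} = {\<lambda>_. 0}"
  proof (intro equalityI subsetI)
    fix a assume "a \<in> {a \<in> mons_deg n 0. a \<notin> I}"
    then have "a \<in> mons n" "mdeg n a = 0" by (simp_all add: mons_deg_def)
    then have "a i = 0" for i using mdeg_ge[of i n a] mons_beyond[of a n i] by (cases "i \<le> n") simp_all
    then show "a \<in> {\<lambda>_. 0}" by auto
  qed (use assms(3) in \<open>simp add: mons_deg_def mons_def mdeg_def\<close>)
  then have "Kcoeff n I 0 \<noteq> 0" by (simp add: Kcoeff_def hilb_def)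
  moreover have "j \<le> j0" if "Kcoeff n I j \<noteq> 0" for j
    using that j0(2)[of j] nle_le by blast
  ultimately have "Kcoeff n I (Kdeg n I) \<noteq> 0"
    unfolding Kdeg_def by (rule GreatestI_nat)
  then have less: "Kdeg n I < j0" using j0(2)[of "Kdeg n I"] not_le by blast
  \<comment> \<open>The bound on the nonzero coefficients makes \<open>GREATEST\<close> meaningful
    for the lexicographic ideal.\<close>
  have "j \<le> mdeg n m + n" if "Kcoeff n (lexP n I) j \<noteq> 0" for j
    using that K0[of j] nle_le unfolding L by blast
  with j0(1) have "j0 \<le> Kdeg n (lexP n I)"
    unfolding Kdeg_def by (rule Greatest_le_nat)
  with less show ?thesis by (simp add: HSdeg_def)
qed

end
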